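(* Let $(a(n))$ be the almost Golomb sequence of order $3$. For every $n\ge 2$: $$a(3n)=a(n-2)+a(n-1)+a(n)+1+\varepsilon(n-1),$$ $$a(3n+1)=a(n-1)+a(n)+a(n+1),$$ $$a(3n+2)=a(n)+a(n+1)+a(n+2)-1-\varepsilon(n).$$
   Context: Consider nondecreasing sequences of positive integers $(a(n))_{n\ge 1}$, extended by $a(k)=0$ for $k\le 0$, such that (1) $a\bigl(a(n)+a(n-1)+a(n-2)\bigr)=n$ for every $n\ge 1$; and (2) for every $n\ge 2$, no integer $m$ with $a(n-1)\le m<a(n)$ satisfies $a\bigl(m+a(n-1)+a(n-2)\bigr)=n$. The almost Golomb sequence of order $3$ is the earliest such sequence, i.e. the lexicographically smallest among the sequences satisfying (1) and (2). It begins $1,2,2,2,3,4,5,5,6,6,6,7,7,8,8,9,10,11,12,13,13,14,15,15,\ldots$ For $k\ge 0$ let $I_k=\left[\frac{11\cdot 3^k-1}{2},\,\frac{13\cdot 3^k-3}{2}\right]\cap\mathbb{Z}$, let $\mathcal{I}=\bigcup_{k\ge 0}I_k$, and let $\varepsilon(n)=1$ if $n\in\mathcal{I}$ and $\varepsilon(n)=0$ otherwise.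
   Formalization: Condition (2) is required only for n ≥ 3 instead of n ≥ 2, because at n = 2 it contradicts (1): a(1)=1 and a(2)=2 are forced, and m=1 gives a(1+1+0)=a(2)=2, so no sequence would qualify. *)

theory Defs
  imports Main "HOL-Library.Fun_Lexorder"
begin

text \<open>Sequences are indexed by the integers so that the convention \<open>a(k) = 0\<close> for \<open>k \<le> 0\<close>
  can be stated literally.\<close>

definition extended_seq :: "(int \<Rightarrow> int) \<Rightarrow> bool" where
  "extended_seq a \<longleftrightarrow>
     (\<forall>k\<le>0. a k = 0) \<and> (\<forall>n\<ge>1. a n > 0) \<and> (\<forall>n\<ge>1. a n \<le> a (n + 1))"

definition golomb_eq3 :: "(int \<Rightarrow> int) \<Rightarrow> bool" where
  "golomb_eq3 a \<longleftrightarrow> (\<forall>n\<ge>1. a (a n + a (n - 1) + a (n - 2)) = n)"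

definition no_smaller_choice3 :: "(int \<Rightarrow> int) \<Rightarrow> int \<Rightarrow> bool" where
  "no_smaller_choice3 a n \<longleftrightarrow>
     \<not> (\<exists>m. a (n - 1) \<le> m \<and> m < a n \<and> a (m + a (n - 1) + a (n - 2)) = n)"

text \<open>The second defining condition is usually written for all \<open>n \<ge> 2\<close>, but it cannot hold
  at \<open>n = 2\<close>: the other requirements force \<open>a(1) = 1\<close> and \<open>a(2) = 2\<close>, and then \<open>m = 1\<close> gives
  \<open>a(m + a(1) + a(0)) = a(2) = 2\<close>. Taken literally, the class of sequences would be empty;
  the condition is therefore imposed from \<open>n = 3\<close> on.\<close>

lemma no_smaller_choice3_fails_at_2:
  assumes "extended_seq a" and "golomb_eq3 a"
  shows "\<not> no_smaller_choice3 a 2"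
proof -
  have zero: "\<And>k. k \<le> 0 \<Longrightarrow> a k = 0" and pos: "\<And>n. n \<ge> 1 \<Longrightarrow> a n > 0"
    and succ: "\<And>n. n \<ge> 1 \<Longrightarrow> a n \<le> a (n + 1)"
    using assms(1) by (auto simp: extended_seq_def)
  have mono: "a i \<le> a j" if "1 \<le> i" "i \<le> j" for i j
    using that(2)
  proof (induction j rule: int_ge_induct)
    case (step j)
    have "a j \<le> a (j + 1)" using succ[of j] step.hyps that(1) by linarith
    then show ?case using step.IH by linarith
  qed simp
  have eq: "\<And>n. n \<ge> 1 \<Longrightarrow> a (a n + a (n - 1) + a (n - 2)) = n"
    using assms(2) by (auto simp: golomb_eq3_def)
  have aa1: "a (a 1) = 1" using eq[of 1] zero by simp
  have a1: "a 1 = 1" using mono[of 1 "a 1"] pos[of 1] aa1 by simp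
  have a2: "a (a 2 + 1) = 2" using eq[of 2] zero a1 by simp
  have "a 2 \<noteq> 1" using a2 by auto
  moreover have "a 2 \<le> 2" using mono[of 2 "a 2 + 1"] pos[of 2] a2 by simp
  ultimately have "a 2 = 2" using pos[of 2] by linarith
  then show ?thesis
    unfolding no_smaller_choice3_def using a1 zero by (auto intro!: exI[of _ 1])
qed

definition almost_golomb_class3 :: "(int \<Rightarrow> int) set" where
  "almost_golomb_class3 =
     {a. extended_seq a \<and> golomb_eq3 a \<and> (\<forall>n\<ge>3. no_smaller_choice3 a n)}"

text \<open>\<^const>\<open>less_fun\<close> compares two functions at the first argument where they differ. All members
  of the class vanish at nonpositive arguments, so this is the lexicographic order on the
  sequences starting at index 1.\<close>

definition almost_golomb3 :: "int \<Rightarrow> int" where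
  "almost_golomb3 =
     (THE a. a \<in> almost_golomb_class3 \<and> (\<forall>b\<in>almost_golomb_class3. b \<noteq> a \<longrightarrow> less_fun a b))"

text \<open>Both numerators are even, so \<open>div\<close> is exact here.\<close>

definition exc_interval :: "nat \<Rightarrow> int set" where
  "exc_interval k = {(11 * 3 ^ k - 1) div 2 .. (13 * 3 ^ k - 3) div 2}"

definition exc_eps :: "int \<Rightarrow> int" where
  "exc_eps n = (if n \<in> (\<Union>k. exc_interval k) then 1 else 0)"

end

theory Submission
  imports Defs
begin

text \<open>
  Write \<open>s(n) = a(n) + a(n-1) + a(n-2)\<close>, the \<open>window\<close> of \<open>n\<close>. The almost Golomb sequence has
  increments 0 and 1, since it takes all positive values. When \<open>n \<ge> 3\<close> and \<open>a(n) = a(n-1) + 1\<close>,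
  the second defining condition says that \<open>a(s(n) - 1)\<close> is not \<open>n\<close>, so the value \<open>n\<close> first
  occurs exactly at the index \<open>s(n)\<close>. Lexicographic minimality asks for the same when \<open>a(n) = a(n-1)\<close>, because
  \<open>s(n)\<close> is the last place where the value \<open>n\<close> may start. So the sequence should be the one that
  jumps to \<open>n\<close> precisely at \<open>s(n)\<close> for every \<open>n \<ge> 3\<close>. The proof therefore takes the sequence
  \<open>rec_seq\<close> that is generated by the claimed recurrences, shows that it jumps at these places,
  and concludes that it is the least member of the class.

  The recurrences read \<open>a(3n) = s(n) + 1 + \<epsilon>(n-1)\<close>, \<open>a(3n+1) = s(n+1)\<close> and
  \<open>a(3n+2) = s(n+2) - 1 - \<epsilon>(n)\<close>. Hence the increments of \<open>a\<close> near \<open>3n\<close> are governed by the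
  rise \<open>D(n) = a(n+2) - a(n-1) = s(n+2) - s(n+1)\<close> over three steps. For \<open>D(n)\<close> between 1 and 3 these
  increments are 0 or 1 exactly if \<open>D(n) = 3\<close> at the exceptional \<open>n\<close> and only there. The reduced
  rise \<open>D - \<epsilon>\<close> satisfies a very simple recursion (\<open>reduced_rise_triple\<close>), from which this follows by induction (\<open>rise_cases\<close>).

  For the jumps (\<open>rec_seq_window\<close>) the recurrences give \<open>s(3n) = 3 s(n) + D(n-1)\<close>,
  \<open>s(3n+1) = 3 s(n) + 2 D(n-1)\<close> and a similar formula for \<open>s(3n+2)\<close>. So a second application of
  the recurrences, now at the indices around \<open>s(n)\<close>, computes \<open>a(s(3n))\<close> from the values of \<open>a\<close>
  around \<open>s(n)\<close>, which are known by induction: \<open>a\<close> jumps to \<open>n\<close> at \<open>s(n)\<close> and next at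
  \<open>s(n+1) = s(n) + D(n-1)\<close>.

  For minimality (\<open>rec_seq_le_at_first_difference\<close>), a member \<open>b\<close> of the class that first
  falls below \<open>rec_seq\<close> at \<open>k\<close> misses a jump there, say the jump to \<open>n\<close>. But then \<open>k = s(n)\<close>, and
  \<open>s(n)\<close> depends only on values at indices below \<open>k\<close>, where both sequences agree. The defining
  equation of \<open>b\<close> at \<open>n\<close> thus forces \<open>b(k) = n\<close>.
\<close>

section \<open>The exceptional set\<close>

lemma exc_interval_0: "exc_interval 0 = {5}"
  by (auto simp: exc_interval_def)

text \<open>Membership at scale \<open>k + 1\<close> is membership at scale \<open>k\<close> after a ternary shift: the
  interval from \<open>p\<close> to \<open>q\<close> is followed by the one from \<open>3p + 1\<close> to \<open>3q + 3\<close>. In this form the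
  exceptional set fits the recurrences, which relate the indices around \<open>3n\<close> to those around
  \<open>n\<close>.\<close>

lemma exc_interval_Suc: "m \<in> exc_interval (Suc k) \<longleftrightarrow> (m - 1) div 3 \<in> exc_interval k"
proof -
  have "odd ((3::int) ^ k)" by simp
  then obtain j :: int where j: "3 ^ k = 2 * j + 1" by (elim oddE)
  have "exc_interval k = {11 * j + 5..13 * j + 5}"
    "exc_interval (Suc k) = {33 * j + 16..39 * j + 18}"
    by (simp_all add: exc_interval_def j)
  then show ?thesis by auto
qed

lemma exc_interval_ge_5:
  assumes "m \<in> exc_interval k"
  shows "5 \<le> m"
proof -
  have "(1::int) \<le> 3 ^ k" by simp
  then have "5 \<le> (11 * 3 ^ k - 1 :: int) div 2" by linarith
  then show ?thesis using assms by (simp add: exc_interval_def)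
qed

lemma exc_eps_rec:
  assumes "m \<ge> 6"
  shows "exc_eps m = exc_eps ((m - 1) div 3)"
proof -
  have "(\<exists>k. m \<in> exc_interval k) \<longleftrightarrow> (\<exists>k. m \<in> exc_interval (Suc k))"
  proof
    assume "\<exists>k. m \<in> exc_interval k"
    then obtain k where k: "m \<in> exc_interval k" ..
    with assms have "k \<noteq> 0" by (auto simp: exc_interval_0 intro: gr0I)
    then obtain i where "k = Suc i" using not0_implies_Suc by blast
    then show "\<exists>k. m \<in> exc_interval (Suc k)" using k by blast
  qed blast
  then show ?thesis by (simp add: exc_eps_def exc_interval_Suc)
qed

lemma exc_eps_small: "m < 5 \<Longrightarrow> exc_eps m = 0" "exc_eps 5 = 1"
proof -
  show "m < 5 \<Longrightarrow> exc_eps m = 0"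
    using exc_interval_ge_5 by (fastforce simp: exc_eps_def)
  have "(5::int) \<in> exc_interval 0" by (simp add: exc_interval_0)
  then show "exc_eps 5 = 1" unfolding exc_eps_def by (metis UN_I UNIV_I)
qed

lemma exc_eps_cases: "exc_eps m = 0 \<or> exc_eps m = 1"
  by (simp add: exc_eps_def)

lemma exc_eps_triple:
  assumes "n \<ge> 2"
  shows "exc_eps (3 * n) = exc_eps (n - 1)" "exc_eps (3 * n + 1) = exc_eps n"
    "exc_eps (3 * n + 2) = exc_eps n"
proof -
  have *: "(3 * n - 1) div 3 = n - 1" "(3 * n + 1) div 3 = n" by presburger+
  show "exc_eps (3 * n) = exc_eps (n - 1)" "exc_eps (3 * n + 1) = exc_eps n"
    "exc_eps (3 * n + 2) = exc_eps n"
    using assms exc_eps_rec[of "3 * n"] exc_eps_rec[of "3 * n + 1"] exc_eps_rec[of "3 * n + 2"] *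
    by simp_all
qed

section \<open>The sequence generated by the recurrences\<close>

text \<open>The values up to index 5 are the ones of the almost Golomb sequence; the recurrences at
  \<open>n \<ge> 2\<close> then produce the indices from 6 on. At \<open>n = 1\<close> the second recurrence would give 3
  instead of 2 at index 4.\<close>

function rec_seq :: "int \<Rightarrow> int" where
  "rec_seq m =
    (if m \<le> 0 then 0 else if m = 1 then 1 else if m \<le> 4 then 2 else if m = 5 then 3
     else let n = m div 3 in
       if m mod 3 = 0 then rec_seq (n - 2) + rec_seq (n - 1) + rec_seq n + 1 + exc_eps (n - 1)
       else if m mod 3 = 1 then rec_seq (n - 1) + rec_seq n + rec_seq (n + 1)
       else rec_seq n + rec_seq (n + 1) + rec_seq (n + 2) - 1 - exc_eps n)"
  by pat_completeness auto
termination
  by (relation "measure nat") auto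

declare rec_seq.simps [simp del]

lemma rec_seq_base:
  "m \<le> 0 \<Longrightarrow> rec_seq m = 0" "rec_seq 1 = 1" "rec_seq 2 = 2" "rec_seq 3 = 2" "rec_seq 4 = 2"
  "rec_seq 5 = 3"
  by (simp_all add: rec_seq.simps)

lemma rec_seq_triple:
  assumes "n \<ge> 2"
  shows "rec_seq (3 * n) = rec_seq (n - 2) + rec_seq (n - 1) + rec_seq n + 1 + exc_eps (n - 1)"
    "rec_seq (3 * n + 1) = rec_seq (n - 1) + rec_seq n + rec_seq (n + 1)"
    "rec_seq (3 * n + 2) = rec_seq n + rec_seq (n + 1) + rec_seq (n + 2) - 1 - exc_eps n"
proof -
  have *: "(3 * n) div 3 = n" "(3 * n) mod 3 = 0" "(3 * n + 1) div 3 = n" "(3 * n + 1) mod 3 = 1"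
    "(3 * n + 2) div 3 = n" "(3 * n + 2) mod 3 = 2"
    by presburger+
  show "rec_seq (3 * n) = rec_seq (n - 2) + rec_seq (n - 1) + rec_seq n + 1 + exc_eps (n - 1)"
    "rec_seq (3 * n + 1) = rec_seq (n - 1) + rec_seq n + rec_seq (n + 1)"
    "rec_seq (3 * n + 2) = rec_seq n + rec_seq (n + 1) + rec_seq (n + 2) - 1 - exc_eps n"
    using assms
    by (subst rec_seq.simps, simp add: * Let_def)+
qed

lemma int_triple_cases:
  fixes m :: int
  obtains n where "m = 3 * n" | n where "m = 3 * n + 1" | n where "m = 3 * n + 2"
proof -
  have "m = 3 * (m div 3) \<or> m = 3 * (m div 3) + 1 \<or> m = 3 * (m div 3) + 2" by presburger
  then show thesis using that by blast
qed

lemma rec_seq_small: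
  "rec_seq 6 = 4" "rec_seq 7 = 5" "rec_seq 8 = 5" "rec_seq 9 = 6" "rec_seq 10 = 6"
  "rec_seq 11 = 6" "rec_seq 12 = 7" "rec_seq 13 = 7" "rec_seq 14 = 8"
  using rec_seq_triple[of 2] rec_seq_triple[of 3] rec_seq_triple[of 4]
  by (simp_all add: rec_seq_base exc_eps_small)

definition rise :: "int \<Rightarrow> int" where
  "rise n = rec_seq (n + 2) - rec_seq (n - 1)"

definition reduced_rise :: "int \<Rightarrow> int" where
  "reduced_rise n = rise n - exc_eps n"

text \<open>A block of three increments is a function of the pair \<open>rise n\<close>, \<open>exc_eps n\<close>. It is
  \<open>(0, 1, 0)\<close>, \<open>(1, 0, 1)\<close> and \<open>(1, 1, 1)\<close> for the pairs \<open>(1, 0)\<close>, \<open>(2, 0)\<close> and \<open>(3, 1)\<close>;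
  for the other pairs with a rise from 1 to 3, some increment is neither 0 nor 1.\<close>

lemma rec_seq_diff:
  assumes "n \<ge> 2"
  shows "rec_seq (3 * n + 2) - rec_seq (3 * n + 1) = reduced_rise n - 1"
    "rec_seq (3 * n + 3) - rec_seq (3 * n + 2) = 2 + exc_eps n - reduced_rise n"
    "rec_seq (3 * n + 4) - rec_seq (3 * n + 3) = reduced_rise n - 1"
  using assms rec_seq_triple[of n] rec_seq_triple[of "n + 1"]
  by (simp_all add: rise_def reduced_rise_def algebra_simps)

text \<open>Adding up three consecutive increments from \<open>rec_seq_diff\<close>, the dependence on the
  exceptional set is absorbed by its own recursion.\<close>

lemma reduced_rise_triple:
  "n \<ge> 3 \<Longrightarrow> reduced_rise (3 * n) = reduced_rise n"
    "n \<ge> 3 \<Longrightarrow> reduced_rise (3 * n + 1) = reduced_rise (n - 1)"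
    "n \<ge> 2 \<Longrightarrow> reduced_rise (3 * n + 2) = reduced_rise n"
  using rec_seq_diff[of n] rec_seq_diff[of "n - 1"] exc_eps_triple[of n]
  by (simp_all add: rise_def reduced_rise_def algebra_simps)

lemma reduced_rise_small:
  "reduced_rise 1 = 2" "reduced_rise 2 = 1" "reduced_rise 3 = 1" "reduced_rise 4 = 2"
  "reduced_rise 5 = 2" "reduced_rise 6 = 2" "reduced_rise 7 = 2" "reduced_rise 8 = 1"
  by (simp_all add: reduced_rise_def rise_def rec_seq_small rec_seq_base exc_eps_small exc_eps_rec)

lemma reduced_rise_cases:
  assumes "n \<ge> 1"
  shows "reduced_rise n = 1 \<or> reduced_rise n = 2"
  using assms
proof (induction "nat n" arbitrary: n rule: less_induct)
  case less
  show ?case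
  proof (cases "n \<le> 8")
    case True
    then have "n \<in> {1,2,3,4,5,6,7,8}" using less.prems by auto
    then show ?thesis by (auto simp: reduced_rise_small)
  next
    case False
    show ?thesis
    proof (cases n rule: int_triple_cases)
      case (1 k)
      then show ?thesis using False less.hyps[of k] by (simp add: reduced_rise_triple)
    next
      case (2 k)
      then show ?thesis using False less.hyps[of "k - 1"] by (simp add: reduced_rise_triple)
    next
      case (3 k)
      then show ?thesis using False less.hyps[of k] by (simp add: reduced_rise_triple)
    qed
  qed
qed

text \<open>The neighbours of \<open>n\<close> make the induction work, since an exceptional \<open>3k\<close> comes from an exceptional \<open>k - 1\<close> but has
  the reduced rise of \<open>k\<close>.\<close>

lemma reduced_rise_near_exceptional:
  assumes "exc_eps n = 1"
  shows "reduced_rise (n - 1) = 2 \<and> reduced_rise n = 2 \<and> reduced_rise (n + 1) = 2"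
  using assms
proof (induction "nat n" arbitrary: n rule: less_induct)
  case less
  have "n \<ge> 5" using less.prems exc_eps_small(1)[of n] by force
  show ?case
  proof (cases "n \<le> 8")
    case True
    then have "n \<in> {5,6,7,8}" using \<open>n \<ge> 5\<close> by auto
    then show ?thesis using less.prems
      by (auto simp: reduced_rise_small exc_eps_small exc_eps_rec)
  next
    case False
    show ?thesis
    proof (cases n rule: int_triple_cases)
      case (1 k)
      have [simp]: "n - 1 = 3 * (k - 1) + 2" using 1 by simp
      show ?thesis using False 1 less.hyps[of "k - 1"] less.prems reduced_rise_triple(3)[of "k - 1"]
        by (simp add: reduced_rise_triple exc_eps_triple)
    next
      case (2 k)
      have "reduced_rise (n + 1) = reduced_rise k"
        using False 2 reduced_rise_triple(3)[of k] by (simp add: add.commute)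
      then show ?thesis using False 2 less.hyps[of k] less.prems
        by (simp add: reduced_rise_triple exc_eps_triple)
    next
      case (3 k)
      have "reduced_rise (n - 1) = reduced_rise (k - 1)" "reduced_rise (n + 1) = reduced_rise (k + 1)"
        using False 3 reduced_rise_triple(2)[of k] reduced_rise_triple(1)[of "k + 1"]
        by (simp_all add: add.commute)
      then show ?thesis using False 3 less.hyps[of k] less.prems
        by (simp add: reduced_rise_triple exc_eps_triple)
    qed
  qed
qed

text \<open>The only way to get rise 3 is reduced rise 2 at an exceptional index, and there the
  reduced rise is never 1.\<close>

lemma rise_cases:
  assumes "n \<ge> 1"
  shows "rise n = 1 \<and> exc_eps n = 0 \<or> rise n = 2 \<and> exc_eps n = 0 \<or> rise n = 3 \<and> exc_eps n = 1"
  using reduced_rise_cases[OF assms] reduced_rise_near_exceptional[of n] exc_eps_cases[of n]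
  by (auto simp: reduced_rise_def)

lemma rec_seq_step: "rec_seq (n + 1) = rec_seq n \<or> rec_seq (n + 1) = rec_seq n + 1"
proof (cases "n \<le> 6")
  case True
  then consider "n < 0" | "n \<in> {0,1,2,3,4,5,6}" by force
  then show ?thesis by cases (auto simp: rec_seq_base rec_seq_small)
next
  case False
  define k where "k = (n - 1) div 3"
  have k: "k \<ge> 2" using False by (simp add: k_def)
  have "n = 3 * k + 1 \<or> n = 3 * k + 2 \<or> n = 3 * k + 3" unfolding k_def by presburger
  then show ?thesis
    using rec_seq_diff[OF k] rise_cases[of k] k by (auto simp: reduced_rise_def algebra_simps)
qed

section \<open>The positions of the jumps\<close>

definition window :: "int \<Rightarrow> int" where
  "window n = rec_seq n + rec_seq (n - 1) + rec_seq (n - 2)"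

lemma window_Suc: "window (n + 1) = window n + rise (n - 1)"
  by (simp add: window_def rise_def algebra_simps)

text \<open>Since \<open>window\<close> itself is tripled up to a small correction, the value of the sequence at
  \<open>window (3 * n)\<close> can be computed by the same recurrences.\<close>

lemma window_triple:
  assumes "n \<ge> 3"
  shows "window (3 * n) = 3 * window n + rise (n - 1)"
    "window (3 * n + 1) = 3 * window n + 2 * rise (n - 1)"
    "window (3 * n + 2) = 3 * window (n + 1) + reduced_rise n - reduced_rise (n - 1)"
  using assms rec_seq_triple[of n] rec_seq_triple[of "n - 1"]
  by (simp_all add: window_def rise_def reduced_rise_def algebra_simps)

lemma rec_seq_mono: "i \<le> j \<Longrightarrow> rec_seq i \<le> rec_seq j"
proof (induction j rule: int_ge_induct)
  case (step j)
  then show ?case using rec_seq_step[of j] by linarith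
qed simp

text \<open>Let \<open>s\<close> be the position of the jump to \<open>n\<close> and \<open>s + r\<close> that of the next jump. The
  recurrences then place the jumps to \<open>3n\<close> and \<open>3n + 1\<close>. The values of the sequence at
  \<open>s - 2\<close> or \<open>s + 2\<close> may be undetermined by this data, but where one of them enters, so
  does the correction \<open>exc_eps\<close> at \<open>s - 1\<close> or \<open>s\<close>, which by \<open>rise_cases\<close> compensates
  for it.\<close>

lemma rec_seq_at_triple_jump:
  assumes "rec_seq s = n" "rec_seq (s - 1) = n - 1"
    and "rec_seq (s + r) = n + 1" "rec_seq (s + r - 1) = n"
    and "r \<in> {1, 2, 3}" "s \<ge> 3"
  shows "rec_seq (3 * s + r) = 3 * n \<and> rec_seq (3 * s + r - 1) = 3 * n - 1"
    "rec_seq (3 * s + 2 * r) = 3 * n + 1 \<and> rec_seq (3 * s + 2 * r - 1) = 3 * n"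
proof -
  have step: "rec_seq (s - 1) = rec_seq (s - 2) \<or> rec_seq (s - 1) = rec_seq (s - 2) + 1"
    "rec_seq (s + 2) = rec_seq (s + 1) \<or> rec_seq (s + 2) = rec_seq (s + 1) + 1"
    using rec_seq_step[of "s - 2"] rec_seq_step[of "s + 1"] by (simp_all add: add.commute)
  have eps: "exc_eps (s - 1) = (if rec_seq (s + 1) - rec_seq (s - 2) = 3 then 1 else 0)"
    "exc_eps s = (if rec_seq (s + 2) - rec_seq (s - 1) = 3 then 1 else 0)"
    "exc_eps (s + 1) = (if rec_seq (s + 3) - rec_seq s = 3 then 1 else 0)"
    using rise_cases[of "s - 1"] rise_cases[of s] rise_cases[of "s + 1"] \<open>s \<ge> 3\<close>
    by (auto simp: rise_def add.commute)
  have rec: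
    "rec_seq (3 * s) = rec_seq (s - 2) + rec_seq (s - 1) + rec_seq s + 1 + exc_eps (s - 1)"
    "rec_seq (3 * s + 1) = rec_seq (s - 1) + rec_seq s + rec_seq (s + 1)"
    "rec_seq (3 * s + 2) = rec_seq s + rec_seq (s + 1) + rec_seq (s + 2) - 1 - exc_eps s"
    "rec_seq (3 * s + 3) = rec_seq (s - 1) + rec_seq s + rec_seq (s + 1) + 1 + exc_eps s"
    "rec_seq (3 * s + 4) = rec_seq s + rec_seq (s + 1) + rec_seq (s + 2)"
    "rec_seq (3 * s + 5) = rec_seq (s + 1) + rec_seq (s + 2) + rec_seq (s + 3) - 1 - exc_eps (s + 1)"
    "rec_seq (3 * s + 6) = rec_seq s + rec_seq (s + 1) + rec_seq (s + 2) + 1 + exc_eps (s + 1)"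
    using rec_seq_triple[of s] rec_seq_triple[of "s + 1"] rec_seq_triple(1)[of "s + 2"] \<open>s \<ge> 3\<close>
    by (simp_all add: algebra_simps)
  from \<open>r \<in> {1, 2, 3}\<close> consider "r = 1" | "r = 2" | "r = 3" by auto
  then have "(rec_seq (3 * s + r) = 3 * n \<and> rec_seq (3 * s + r - 1) = 3 * n - 1)
    \<and> (rec_seq (3 * s + 2 * r) = 3 * n + 1 \<and> rec_seq (3 * s + 2 * r - 1) = 3 * n)"
  proof cases
    case 1
    have "rec_seq (s + 1) = n + 1" using assms 1 by simp
    then have "rec_seq (s - 2) + exc_eps (s - 1) = n - 1" "rec_seq (s + 2) - exc_eps s = n + 1"
      using assms(1,2) step eps by auto
    then have "rec_seq (3 * s) = 3 * n - 1" "rec_seq (3 * s + 1) = 3 * n"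
      "rec_seq (3 * s + 2) = 3 * n + 1"
      using rec assms(1,2) \<open>rec_seq (s + 1) = n + 1\<close> by linarith+
    then show ?thesis using 1 by (simp add: add.commute)
  next
    case 2
    have "rec_seq (s + 1) = n" "rec_seq (s + 2) = n + 1"
      using assms 2 by (simp_all add: add.commute)
    moreover from this have "exc_eps s = 0" using assms(2) eps by simp
    ultimately have "rec_seq (3 * s + 1) = 3 * n - 1" "rec_seq (3 * s + 2) = 3 * n"
      "rec_seq (3 * s + 3) = 3 * n" "rec_seq (3 * s + 4) = 3 * n + 1"
      using rec assms(1,2) by linarith+
    then show ?thesis using 2 by (simp add: add.commute)
  next
    case 3
    have "rec_seq (s + 2) = n" "rec_seq (s + 3) = n + 1"
      using assms 3 by (simp_all add: add.commute)
    moreover from this have "rec_seq (s + 1) = n"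
      using rec_seq_mono[of s "s + 1"] rec_seq_mono[of "s + 1" "s + 2"] assms(1) by simp
    moreover from calculation have "exc_eps s = 0" "exc_eps (s + 1) = 0"
      using assms(1,2) eps by simp_all
    ultimately have "rec_seq (3 * s + 2) = 3 * n - 1" "rec_seq (3 * s + 3) = 3 * n"
      "rec_seq (3 * s + 5) = 3 * n" "rec_seq (3 * s + 6) = 3 * n + 1"
      using rec assms(1,2) by linarith+
    then show ?thesis using 3 by (simp add: add.commute)
  qed
  then show "rec_seq (3 * s + r) = 3 * n \<and> rec_seq (3 * s + r - 1) = 3 * n - 1"
    "rec_seq (3 * s + 2 * r) = 3 * n + 1 \<and> rec_seq (3 * s + 2 * r - 1) = 3 * n"
    by blast+
qed

text \<open>The jump to \<open>3n + 2\<close> is close to \<open>3t\<close>, where \<open>t\<close> is the position of the jump to \<open>n + 1\<close>.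
  Its offset depends on \<open>u\<close> and \<open>v\<close>, which tell whether the value \<open>n + 1\<close> right after \<open>t\<close>, and
  the value \<open>n\<close> right before \<open>t\<close>, occurs once or more often. They will be the reduced rises at
  \<open>n\<close> and \<open>n - 1\<close>.\<close>

lemma rec_seq_at_triple_jump_middle:
  assumes "rec_seq t = n + 1" "rec_seq (t - 1) = n"
    and "u = 1 \<and> rec_seq (t + 1) = n + 2 \<or> u = 2 \<and> rec_seq (t + 1) = n + 1"
    and "v = 1 \<and> rec_seq (t - 2) = n - 1 \<or> v = 2 \<and> rec_seq (t - 2) = n"
    and "t \<ge> 4"
  shows "rec_seq (3 * t + u - v) = 3 * n + 2 \<and> rec_seq (3 * t + u - v - 1) = 3 * n + 1"
proof -
  have rise: "rise (t - 1) = rec_seq (t + 1) - rec_seq (t - 2)"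
    by (simp add: rise_def add.commute)
  have eps: "rise (t - 1) = 1 \<and> exc_eps (t - 1) = 0 \<or> rise (t - 1) = 2 \<and> exc_eps (t - 1) = 0
      \<or> rise (t - 1) = 3 \<and> exc_eps (t - 1) = 1"
    using \<open>t \<ge> 4\<close> by (intro rise_cases) simp
  have rec:
    "rec_seq (3 * t - 2) = rec_seq (t - 2) + rec_seq (t - 1) + rec_seq t"
    "rec_seq (3 * t - 1) = rec_seq (t - 1) + rec_seq t + rec_seq (t + 1) - 1 - exc_eps (t - 1)"
    "rec_seq (3 * t) = rec_seq (t - 2) + rec_seq (t - 1) + rec_seq t + 1 + exc_eps (t - 1)"
    "rec_seq (1 + 3 * t) = rec_seq (t - 1) + rec_seq t + rec_seq (t + 1)"
    using rec_seq_triple[of "t - 1"] rec_seq_triple[of t] \<open>t \<ge> 4\<close>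
    by (simp_all add: algebra_simps)
  show ?thesis using assms(3,4)
    by (elim disjE conjE) (use assms(1,2) rise eps in \<open>auto simp: rec\<close>)
qed

text \<open>At \<open>n = 2\<close> the second equation fails: \<open>window 2 = 3\<close>, but the value 2 already occurs at
  index 2. The induction step from \<open>k = n div 3\<close> therefore needs \<open>k \<ge> 3\<close>, and the indices up to 8
  are checked by computation.\<close>

lemma rec_seq_window:
  assumes "n \<ge> 3"
  shows "rec_seq (window n) = n \<and> rec_seq (window n - 1) = n - 1"
  using assms
proof (induction "nat n" arbitrary: n rule: less_induct)
  case less
  show ?case
  proof (cases "n \<le> 8")
    case True
    then have "n \<in> {3,4,5,6,7,8}" using less.prems by auto
    then show ?thesis by (auto simp: window_def rec_seq_base rec_seq_small)
  next
    case False
    define k where "k = n div 3"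
    have k: "3 \<le> k" "k + 2 < n" "k \<le> n" using False by (simp_all add: k_def)
    have IH: "rec_seq (window m) = m" "rec_seq (window m - 1) = m - 1"
      if "3 \<le> m" "m < n" for m
      using less.hyps[of m] that by simp_all
    define s t where "s = window k" and "t = window (k + 1)"
    have r: "rise (k - 1) \<in> {1, 2, 3}" using rise_cases[of "k - 1"] k by auto
    have s: "rec_seq s = k" "rec_seq (s - 1) = k - 1"
      using IH[of k] k by (simp_all add: s_def)
    have t: "rec_seq t = k + 1" "rec_seq (t - 1) = k" "t = s + rise (k - 1)"
      using IH[of "k + 1"] k by (simp_all add: s_def t_def window_Suc)
    have "s \<ge> 5"
    proof (rule ccontr)
      assume "\<not> s \<ge> 5"
      then have "rec_seq s \<le> rec_seq 4" by (intro rec_seq_mono) simp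
      then show False using s k by (simp add: rec_seq_base)
    qed
    have "n = 3 * k \<or> n = 3 * k + 1 \<or> n = 3 * k + 2" unfolding k_def by presburger
    then show ?thesis
    proof (elim disjE)
      assume "n = 3 * k"
      then show ?thesis
        using rec_seq_at_triple_jump(1)[of s k "rise (k - 1)"] s t r \<open>s \<ge> 5\<close> k
        by (simp add: window_triple s_def)
    next
      assume "n = 3 * k + 1"
      then show ?thesis
        using rec_seq_at_triple_jump(2)[of s k "rise (k - 1)"] s t r \<open>s \<ge> 5\<close> k
        by (simp add: window_triple s_def)
    next
      assume n: "n = 3 * k + 2"
      have next_jump: "rec_seq (t + rise k) = k + 2" "rec_seq (t + rise k - 1) = k + 1"
        using IH[of "k + 2"] k window_Suc[of "k + 1"] by (simp_all add: t_def algebra_simps)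
      have u: "reduced_rise k = 1 \<and> rec_seq (t + 1) = k + 2
        \<or> reduced_rise k = 2 \<and> rec_seq (t + 1) = k + 1"
        using rise_cases[of k] k next_jump t rec_seq_mono[of t "t + 1"]
          rec_seq_mono[of "t + 1" "t + rise k - 1"]
        by (auto simp: reduced_rise_def)
      have v: "reduced_rise (k - 1) = 1 \<and> rec_seq (t - 2) = k - 1
        \<or> reduced_rise (k - 1) = 2 \<and> rec_seq (t - 2) = k"
        using rise_cases[of "k - 1"] k s t rec_seq_mono[of s "t - 2"]
          rec_seq_mono[of "t - 2" "t - 1"]
        by (auto simp: reduced_rise_def)
      show ?thesis
        using rec_seq_at_triple_jump_middle[OF t(1,2) u v] t(3) r \<open>s \<ge> 5\<close> k(1) n
          window_triple(3)[OF k(1)]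
        by (auto simp: t_def[symmetric])
    qed
  qed
qed

section \<open>Identification with the almost Golomb sequence\<close>

lemma rec_seq_ge_1: "n \<ge> 1 \<Longrightarrow> rec_seq n \<ge> 1"
  using rec_seq_mono[of 1 n] by (simp add: rec_seq_base)

lemma rec_seq_less: "n \<ge> 3 \<Longrightarrow> rec_seq n < n"
proof (induction n rule: int_ge_induct)
  case (step n)
  then show ?case using rec_seq_step[of n] by linarith
qed (simp add: rec_seq_base)

text \<open>The second condition holds because any smaller choice moves the argument to the left of
  \<open>window n\<close>, where the value \<open>n\<close> has not yet been reached.\<close>

lemma rec_seq_in_class: "rec_seq \<in> almost_golomb_class3"
proof -
  have "extended_seq rec_seq"
    using rec_seq_ge_1 by (fastforce simp: extended_seq_def rec_seq_base intro: rec_seq_mono)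
  moreover have "golomb_eq3 rec_seq"
    unfolding golomb_eq3_def
  proof (intro allI impI)
    fix n :: int
    assume "n \<ge> 1"
    then consider "n = 1" | "n = 2" | "n \<ge> 3" by linarith
    then show "rec_seq (rec_seq n + rec_seq (n - 1) + rec_seq (n - 2)) = n"
      using rec_seq_window[of n] by cases (auto simp: rec_seq_base window_def)
  qed
  moreover have "no_smaller_choice3 rec_seq n" if "n \<ge> 3" for n
    unfolding no_smaller_choice3_def
  proof
    assume "\<exists>m. rec_seq (n - 1) \<le> m \<and> m < rec_seq n
      \<and> rec_seq (m + rec_seq (n - 1) + rec_seq (n - 2)) = n"
    then obtain m where m: "m < rec_seq n"
        "rec_seq (m + rec_seq (n - 1) + rec_seq (n - 2)) = n"
      by blast
    then have "n \<le> rec_seq (window n - 1)"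
      using rec_seq_mono[of "m + rec_seq (n - 1) + rec_seq (n - 2)" "window n - 1"]
      by (simp add: window_def)
    then show False using rec_seq_window[OF that] by simp
  qed
  ultimately show ?thesis by (simp add: almost_golomb_class3_def)
qed

lemma jump_position:
  assumes "rec_seq (k - 1) = n - 1" "rec_seq k = n" "n \<ge> 3"
  shows "k = window n"
proof (rule ccontr)
  assume "k \<noteq> window n"
  then consider "k \<le> window n - 1" | "window n \<le> k - 1" by linarith
  then show False
    using rec_seq_mono[of k "window n - 1"] rec_seq_mono[of "window n" "k - 1"]
      rec_seq_window[OF \<open>n \<ge> 3\<close>] assms(1,2)
    by cases linarith+
qed

text \<open>If \<open>b\<close> stays behind at \<open>k\<close>, then \<open>rec_seq\<close> jumps there to some \<open>n\<close>. For \<open>n \<ge> 3\<close> the jump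
  position \<open>k = window n\<close> involves only indices up to \<open>n < k\<close>, so \<open>b\<close> has the same window and
  must equal \<open>n\<close> at \<open>k\<close>. For \<open>n = 2\<close> the jump is at \<open>k = 2\<close>, which is not \<open>window 2\<close>; but there
  \<open>b 2 = 1\<close> would give \<open>b\<close> the window 2 at 2, so that \<open>b 2 = 2\<close> by the defining equation.\<close>

lemma rec_seq_le_at_first_difference:
  assumes b: "extended_seq b" "golomb_eq3 b"
    and agree: "\<And>i. i < k \<Longrightarrow> b i = rec_seq i"
  shows "rec_seq k \<le> b k"
proof (rule ccontr)
  assume "\<not> rec_seq k \<le> b k"
  then have less: "b k < rec_seq k" by simp
  have b_zero: "b i = 0" if "i \<le> 0" for i using b(1) that unfolding extended_seq_def by blast
  have b_pos: "b i > 0" and b_step: "b i \<le> b (i + 1)" if "i \<ge> 1" for i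
    using b(1) that unfolding extended_seq_def by blast+
  have "\<not> k \<le> 0" using less b_zero[of k] by (auto simp: rec_seq_base)
  moreover have "k \<noteq> 1" using less b_pos[of 1] by (auto simp: rec_seq_base)
  ultimately have "k \<ge> 2" by simp
  have "b (k - 1) \<le> b k" using b_step[of "k - 1"] \<open>k \<ge> 2\<close> by simp
  moreover have "b (k - 1) = rec_seq (k - 1)" by (rule agree) simp
  moreover have "rec_seq k = rec_seq (k - 1) \<or> rec_seq k = rec_seq (k - 1) + 1"
    using rec_seq_step[of "k - 1"] by simp
  ultimately have bk: "b k = rec_seq k - 1" and prev: "rec_seq (k - 1) = rec_seq k - 1"
    using less by linarith+
  have eq: "b (b n + b (n - 1) + b (n - 2)) = n" if "n \<ge> 1" for n
    using b(2) that unfolding golomb_eq3_def by blast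
  define n where "n = rec_seq k"
  have "n \<ge> 2" using prev rec_seq_ge_1[of "k - 1"] \<open>k \<ge> 2\<close> by (simp add: n_def)
  then consider "n = 2" | "n \<ge> 3" by linarith
  then show False
  proof cases
    case 1
    have "\<not> 2 \<le> k - 1"
      using rec_seq_mono[of 2 "k - 1"] prev 1 by (auto simp: rec_seq_base n_def)
    then have "k = 2" using \<open>k \<ge> 2\<close> by simp
    then have "b 2 = 1" "b 1 = 1" using bk agree[of 1] by (simp_all add: rec_seq_base)
    then have "b 2 = 2" using eq[of 2] b_zero[of 0] by simp
    then show False using \<open>b 2 = 1\<close> by simp
  next
    case 2
    have "k = window n" using prev 2 by (intro jump_position) (simp_all add: n_def)
    moreover have "n < k"
    proof -
      have "k \<noteq> 2" using 2 by (auto simp: n_def rec_seq_base)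
      then show ?thesis using rec_seq_less[of k] \<open>k \<ge> 2\<close> by (simp add: n_def)
    qed
    then have "b n = rec_seq n" "b (n - 1) = rec_seq (n - 1)" "b (n - 2) = rec_seq (n - 2)"
      by (simp_all add: agree)
    ultimately have "b n + b (n - 1) + b (n - 2) = k" by (simp only: window_def)
    moreover have "b (b n + b (n - 1) + b (n - 2)) = n" using 2 by (intro eq) simp
    ultimately have "b k = n" by (simp only:)
    then show False using bk by (simp add: n_def)
  qed
qed

lemma int_first_difference:
  fixes f g :: "int \<Rightarrow> 'a"
  assumes "f \<noteq> g" and "\<And>i. i \<le> 0 \<Longrightarrow> f i = g i"
  obtains k where "f k \<noteq> g k" "\<And>i. i < k \<Longrightarrow> f i = g i"
proof -
  obtain i where i: "f i \<noteq> g i" using assms(1) by blast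
  define m where "m = (LEAST m::nat. f (int m) \<noteq> g (int m))"
  have "i > 0" using i assms(2)[of i] by force
  then have "f (int (nat i)) \<noteq> g (int (nat i))" using i by simp
  then have "f (int m) \<noteq> g (int m)" unfolding m_def by (rule LeastI)
  moreover have "f j = g j" if "j < int m" for j
  proof (cases "j \<le> 0")
    case False
    then have "nat j < m" using that by linarith
    then have "f (int (nat j)) = g (int (nat j))" unfolding m_def using not_less_Least by blast
    then show ?thesis using False by simp
  qed (rule assms(2))
  ultimately show thesis using that by blast
qed

lemma rec_seq_least:
  assumes "b \<in> almost_golomb_class3" "b \<noteq> rec_seq"
  shows "less_fun rec_seq b"
proof -
  have b: "extended_seq b" "golomb_eq3 b" using assms(1) by (auto simp: almost_golomb_class3_def)
  then have "b i = rec_seq i" if "i \<le> 0" for i using that by (simp add: extended_seq_def rec_seq_base)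
  then obtain k where k: "b k \<noteq> rec_seq k" "\<And>i. i < k \<Longrightarrow> b i = rec_seq i"
    using int_first_difference[OF assms(2)] by blast
  then have "rec_seq k < b k"
    using rec_seq_le_at_first_difference[OF b, of k] by force
  then show ?thesis using k(2) by (auto simp: less_fun_def)
qed

lemma almost_golomb3_eq_rec_seq: "almost_golomb3 = rec_seq"
  unfolding almost_golomb3_def
proof (rule the_equality)
  show "rec_seq \<in> almost_golomb_class3
    \<and> (\<forall>b\<in>almost_golomb_class3. b \<noteq> rec_seq \<longrightarrow> less_fun rec_seq b)"
    using rec_seq_in_class rec_seq_least by blast
next
  fix a
  assume "a \<in> almost_golomb_class3
    \<and> (\<forall>b\<in>almost_golomb_class3. b \<noteq> a \<longrightarrow> less_fun a b)"
  then show "a = rec_seq" using rec_seq_in_class rec_seq_least less_fun_asym by metis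
qed

theorem theorem4p9:
  fixes a :: "int \<Rightarrow> int" and n :: int
  assumes "a = almost_golomb3" and "n \<ge> 2"
  shows "a (3 * n) = a (n - 2) + a (n - 1) + a n + 1 + exc_eps (n - 1)
    \<and> a (3 * n + 1) = a (n - 1) + a n + a (n + 1)
    \<and> a (3 * n + 2) = a n + a (n + 1) + a (n + 2) - 1 - exc_eps n"
  using rec_seq_triple[OF assms(2)] by (simp add: assms(1) almost_golomb3_eq_rec_seq)

end
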